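(* Let $i\ge 0$ be an integer, let $n$ be an integer with $0<n<2^i$, and let $k=\lceil \log_2(n)\rceil$. Then $$f(n,i) = f(n,k) + (i-k)\cdot f(2^k-n,k).$$
   Context: For an integer $n$ and an integer $i\ge 0$, $f(n,i)$ denotes the number of binary signed-digit (BSD) representations of $n$ on $i$ bits, i.e. the number of tuples $(b_{i-1},\dots,b_0)\in\{1,0,-1\}^i$ with $n=\sum_{j=0}^{i-1} b_j 2^j$ (for $i=0$ the only tuple is the empty one, representing $0$). *)

theory Defs
  imports Complex_Main "HOL-Library.FuncSet"
begin

text \<open>
  A tuple \<open>(b\<^sub>i\<^sub>-\<^sub>1, \<dots>, b\<^sub>0)\<close> is a function on the index set \<open>{..<i}\<close>. The extensional function
  space makes such functions unique outside that set, so that counting them counts tuples.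
\<close>

definition bsd_reps :: "int \<Rightarrow> nat \<Rightarrow> (nat \<Rightarrow> int) set" where
  "bsd_reps n i = {b \<in> {..<i} \<rightarrow>\<^sub>E {1, 0, -1}. n = (\<Sum>j<i. b j * 2 ^ j)}"

definition bsd_count :: "int \<Rightarrow> nat \<Rightarrow> nat" where
  "bsd_count n i = card (bsd_reps n i)"

end

theory Submission
  imports Defs
begin

text \<open>
  Splitting off the leading digit gives
  \<open>f(n, i + 1) = f(n, i) + f(n - 2\<^sup>i, i) + f(n + 2\<^sup>i, i)\<close>.
  For \<open>n > 0\<close> the last term vanishes because \<open>i\<close> digits only reach absolute values below \<open>2\<^sup>i\<close>,
  and negating all digits turns the middle term into \<open>f(2\<^sup>i - n, i)\<close>. For \<open>n \<le> 2\<^sup>i\<close> the same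
  splitting shows that \<open>f(2\<^sup>i - n, i)\<close> does not change when \<open>i\<close> grows, so each digit beyond
  the \<open>k\<close>-th contributes the same amount \<open>f(2\<^sup>k - n, k)\<close>.
\<close>

lemma finite_bsd_reps: "finite (bsd_reps n i)"
proof -
  have "finite ({..<i} \<rightarrow>\<^sub>E {1, 0, -1 :: int})"
    by (intro finite_PiE) auto
  then show ?thesis
    by (simp add: bsd_reps_def)
qed

lemma bsd_reps_digit: "b \<in> bsd_reps n i \<Longrightarrow> j < i \<Longrightarrow> b j \<in> {1, 0, -1}"
  unfolding bsd_reps_def by (blast dest: PiE_mem)

lemma bsd_reps_abs_less:
  assumes "b \<in> bsd_reps n i"
  shows "\<bar>n\<bar> < 2 ^ i"
proof -
  have "\<bar>n\<bar> \<le> (\<Sum>j<i. \<bar>b j * 2 ^ j\<bar>)"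
    using assms by (simp add: bsd_reps_def sum_abs)
  also have "\<dots> \<le> (\<Sum>j<i. 2 ^ j)"
  proof (rule sum_mono)
    fix j
    assume "j \<in> {..<i}"
    then have "b j \<in> {1, 0, -1}"
      using bsd_reps_digit[OF assms] by blast
    then show "\<bar>b j * 2 ^ j\<bar> \<le> 2 ^ j"
      by auto
  qed
  also have "\<dots> < (2 ^ i :: int)"
    by (induction i) auto
  finally show ?thesis .
qed

lemma bsd_count_eq_0:
  assumes "2 ^ i \<le> \<bar>n\<bar>"
  shows "bsd_count n i = 0"
proof -
  have "bsd_reps n i = {}"
    using assms bsd_reps_abs_less by fastforce
  then show ?thesis
    by (simp add: bsd_count_def)
qed

lemma bsd_count_uminus: "bsd_count (- n) i = bsd_count n i"
  unfolding bsd_count_def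
proof (rule bij_betw_same_card)
  \<comment> \<open>Plain negation would give \<open>- undefined\<close> outside the index set. With
    \<open>restrict\<close> the result stays extensional and \<open>?neg\<close> is its own inverse
    on representations.\<close>
  let ?neg = "\<lambda>b. restrict (\<lambda>j. - b j) {..<i}"
  have neg_mem: "?neg b \<in> bsd_reps (- m) i" if "b \<in> bsd_reps m i" for b m
  proof -
    have "- b j \<in> {1, 0, -1}" if "j < i" for j
      using bsd_reps_digit[OF \<open>b \<in> bsd_reps m i\<close> that] by auto
    then have "?neg b \<in> {..<i} \<rightarrow>\<^sub>E {1, 0, -1}"
      by simp
    then show ?thesis
      using that by (simp add: bsd_reps_def sum_negf)
  qed
  have neg_neg: "?neg (?neg b) = b" if "b \<in> bsd_reps m i" for b m
  proof
    show "?neg (?neg b) j = b j" for j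
      using that PiE_arb[of b "{..<i}" "\<lambda>_. {1, 0, -1}" j] by (simp add: bsd_reps_def)
  qed
  show "bij_betw ?neg (bsd_reps (- n) i) (bsd_reps n i)"
    by (rule bij_betw_byWitness[where f' = ?neg])
      (use neg_mem[of _ n] neg_mem[of _ "- n"] neg_neg in auto)
qed

lemma bsd_count_Suc:
  "bsd_count n (Suc i) = bsd_count n i + bsd_count (n - 2 ^ i) i + bsd_count (n + 2 ^ i) i"
proof -
  let ?D = "{1, 0, -1 :: int}"
  have "bij_betw (\<lambda>(c, b). b(i := c)) (SIGMA c:?D. bsd_reps (n - c * 2 ^ i) i) (bsd_reps n (Suc i))"
    (is "bij_betw ?f ?S _")
  \<comment> \<open>The inverse reads off the leading digit and resets position \<open>i\<close> to
    \<open>undefined\<close>, so that the remaining tuple is extensional on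
    \<open>{..<i}\<close>.\<close>
  proof (rule bij_betw_byWitness[where f' = "\<lambda>b. (b i, b(i := undefined))"])
    show "\<forall>p\<in>?S. ((?f p) i, (?f p)(i := undefined)) = p"
    proof
      fix p
      assume "p \<in> ?S"
      then obtain c b where p: "p = (c, b)" and b: "b \<in> bsd_reps (n - c * 2 ^ i) i"
        by blast
      then have "b i = undefined"
        unfolding bsd_reps_def using PiE_arb[of b "{..<i}" _ i] by blast
      then show "((?f p) i, (?f p)(i := undefined)) = p"
        by (simp add: p fun_upd_idem)
    qed
    show "\<forall>b\<in>bsd_reps n (Suc i). ?f (b i, b(i := undefined)) = b"
      by auto
    show "?f ` ?S \<subseteq> bsd_reps n (Suc i)"
    proof clarify
      fix c b
      assume c: "c \<in> ?D" and b: "b \<in> bsd_reps (n - c * 2 ^ i) i"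
      have "b(i := c) \<in> {..<Suc i} \<rightarrow>\<^sub>E ?D"
        unfolding lessThan_Suc using b c by (intro fun_upd_in_PiE PiE_fun_upd) (auto simp: bsd_reps_def)
      then show "b(i := c) \<in> bsd_reps n (Suc i)"
        using b by (simp add: bsd_reps_def algebra_simps)
    qed
    show "(\<lambda>b. (b i, b(i := undefined))) ` bsd_reps n (Suc i) \<subseteq> ?S"
    proof clarify
      fix b
      assume b: "b \<in> bsd_reps n (Suc i)"
      then have "b i \<in> ?D"
        by (rule bsd_reps_digit) simp
      moreover have "b(i := undefined) \<in> {..<i} \<rightarrow>\<^sub>E ?D"
        using b unfolding bsd_reps_def lessThan_Suc by (intro fun_upd_in_PiE) auto
      ultimately show "b i \<in> ?D \<and> b(i := undefined) \<in> bsd_reps (n - b i * 2 ^ i) i"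
        using b by (simp add: bsd_reps_def algebra_simps)
    qed
  qed
  then have "bsd_count n (Suc i) = card ?S"
    unfolding bsd_count_def by (metis bij_betw_same_card)
  also have "\<dots> = (\<Sum>c\<in>?D. bsd_count (n - c * 2 ^ i) i)"
    by (subst card_SigmaI) (auto simp: finite_bsd_reps bsd_count_def)
  finally show ?thesis
    by simp
qed

text \<open>The leading digit of \<open>2 ^ (k + d + 1) - n\<close> on \<open>k + d + 1\<close> bits
  must be 1: after a 0 or -1 the remainder is at least \<open>2 ^ (k + d)\<close>, out of reach of
  the lower digits. Removing the 1 leaves \<open>2 ^ (k + d) - n\<close>.\<close>

lemma bsd_count_complement:
  assumes "0 < n" and "n \<le> 2 ^ k"
  shows "bsd_count (2 ^ (k + d) - n) (k + d) = bsd_count (2 ^ k - n) k"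
proof (induction d)
  case (Suc d)
  have "n \<le> 2 ^ (k + d)"
    using assms(2) by (rule order_trans) (simp add: power_increasing)
  then have "bsd_count (2 * 2 ^ (k + d) - n) (k + d) = 0"
    "bsd_count (2 * 2 ^ (k + d) - n + 2 ^ (k + d)) (k + d) = 0"
    by (auto intro!: bsd_count_eq_0)
  moreover have "2 * 2 ^ (k + d) - n - 2 ^ (k + d) = 2 ^ (k + d) - n"
    by simp
  ultimately show ?case
    using Suc by (simp add: bsd_count_Suc)
qed simp

text \<open>Induction on the number of extra digits: a leading 0 leaves \<open>n\<close> itself, a
  leading 1 contributes the constant complement count, a leading -1 nothing. The case
  \<open>n = 2 ^ k\<close> has to be covered, since the ceiling of the logarithm produces it when
  \<open>n\<close> is a power of two.\<close>

lemma bsd_count_add: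
  assumes "0 < n" and "n \<le> 2 ^ k"
  shows "bsd_count n (k + d) = bsd_count n k + d * bsd_count (2 ^ k - n) k"
proof (induction d)
  case (Suc d)
  have "bsd_count (n + 2 ^ (k + d)) (k + d) = 0"
    using assms(1) by (intro bsd_count_eq_0) simp
  moreover have "bsd_count (n - 2 ^ (k + d)) (k + d) = bsd_count (2 ^ k - n) k"
    using bsd_count_uminus[of "2 ^ (k + d) - n"] bsd_count_complement[OF assms] by simp
  ultimately show ?case
    using Suc by (simp add: bsd_count_Suc)
qed simp

theorem theorem7:
  fixes i k :: nat and n :: int
  assumes "0 < n" and "n < 2 ^ i"
    and "int k = \<lceil>log 2 (real_of_int n)\<rceil>"
  shows "int (bsd_count n i) =
    int (bsd_count n k) + (int i - int k) * int (bsd_count (2 ^ k - n) k)"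
proof -
  have "log 2 (real_of_int n) \<le> real k"
    using assms(3) by linarith
  then have "real_of_int n \<le> 2 ^ k"
    using assms(1) by (simp add: log_le_iff powr_realpow)
  then have n_le: "n \<le> 2 ^ k"
    by (metis of_int_le_iff of_int_numeral of_int_power)
  have "real_of_int n < 2 ^ i"
    using assms(2) by (metis of_int_less_iff of_int_numeral of_int_power)
  then have "log 2 (real_of_int n) < real i"
    using assms(1) by (simp add: log_less_iff powr_realpow)
  \<comment> \<open>The ceiling is less than \<open>log 2 n + 1\<close>, hence
    \<open>k < i + 1\<close>. This turns the integer difference \<open>int i - int k\<close> into
    the natural number \<open>d\<close> of extra digits.\<close>
  then have "k \<le> i"
    using assms(3) by linarith
  then obtain d where "i = k + d"
    using le_Suc_ex by blast
  then show ?thesis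
    using bsd_count_add[OF assms(1) n_le] by simp
qed

end
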